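(* For each edit type $\mathrm{edit} \in \{\mathrm{sub}, \mathrm{ins}, \mathrm{del}\}$, $\mathrm{AS}_{\mathrm{edit}}(z_{78}, n) = \Omega(n)$.
   Context: Strings are over an alphabet $\Sigma$ that is not of bounded size (strings may use arbitrarily many distinct characters). The LZ78 factorization of a string $T$ is $T = f_1\cdots f_z$ where each phrase $f_k$ is the shortest prefix of the remaining suffix $T[|f_1\cdots f_{k-1}|+1..n]$ that differs from all previous phrases $f_1,\dots,f_{k-1}$ (so $f_k$ with its last character removed is empty or equals some earlier phrase); the last phrase may equal an earlier phrase if the string ends. $z_{78}(T)$ denotes the number of phrases. For a measure $c$, $\mathrm{AS}_{\mathrm{edit}}(c,n) = \max\{c(T')-c(T)\}$ over all strings $T$ of length $n$ and all $T'$ obtained from $T$ by a single edit of the given type (substitution, insertion or deletion of one character). $\Omega(n)$ means there is a constant $C>0$ with $\mathrm{AS}_{\mathrm{edit}}(z_{78},n) \ge C n$ for infinitely many $n$. *)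

theory Defs
  imports Complex_Main
begin

text \<open>Length of the next phrase when the string \<open>T\<close> remains to be factorized and \<open>D\<close> is the set
  of phrases found so far: the length of the shortest nonempty prefix of \<open>T\<close> that is not in \<open>D\<close>.
  If every nonempty prefix is in \<open>D\<close>, the string ends inside a phrase and all of \<open>T\<close> becomes
  the last phrase, equal to an earlier one.\<close>

definition phrase_len :: "'a list set \<Rightarrow> 'a list \<Rightarrow> nat" where
  "phrase_len D T =
    (if \<exists>l. 1 \<le> l \<and> l \<le> length T \<and> take l T \<notin> D
     then LEAST l. 1 \<le> l \<and> l \<le> length T \<and> take l T \<notin> D
     else length T)"

lemma phrase_len_bounds:
  assumes "T \<noteq> []"
  shows "1 \<le> phrase_len D T" and "phrase_len D T \<le> length T"
proof -
  let ?P = "\<lambda>l. 1 \<le> l \<and> l \<le> length T \<and> take l T \<notin> D"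
  have "1 \<le> phrase_len D T \<and> phrase_len D T \<le> length T"
  proof (cases "\<exists>l. ?P l")
    case True
    then have "?P (LEAST l. ?P l)" by (rule LeastI_ex)
    with True show ?thesis by (simp add: phrase_len_def)
  next
    case False
    then have "phrase_len D T = length T" unfolding phrase_len_def by (rule if_not_P)
    with assms show ?thesis by (cases T) auto
  qed
  then show "1 \<le> phrase_len D T" and "phrase_len D T \<le> length T" by auto
qed

function lz78_from :: "'a list set \<Rightarrow> 'a list \<Rightarrow> 'a list list" where
  "lz78_from D T =
    (if T = [] then []
     else let l = phrase_len D T; f = take l T
          in f # lz78_from (insert f D) (drop l T))"
  by pat_completeness auto
termination
proof (relation "measure (\<lambda>(D, T). length T)", goal_cases)
  case 1
  then show ?case by simp
next
  case (2 D T l f)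
  then show ?case using phrase_len_bounds(1)[of T D] by simp
qed

declare lz78_from.simps [simp del]

definition lz78 :: "'a list \<Rightarrow> 'a list list" where
  "lz78 T = lz78_from {} T"

lemma concat_lz78_from: "concat (lz78_from D T) = T"
  by (induction D T rule: lz78_from.induct) (subst lz78_from.simps, simp add: Let_def)

lemma concat_lz78: "concat (lz78 T) = T"
  by (simp add: lz78_def concat_lz78_from)

definition z78 :: "'a list \<Rightarrow> nat" where
  "z78 T = length (lz78 T)"

datatype edit = Sub | Ins | Del

fun edits :: "edit \<Rightarrow> 'a list \<Rightarrow> 'a list set" where
  "edits Sub T = {T[i := a] | i a. i < length T \<and> a \<noteq> T ! i}"
| "edits Ins T = {take i T @ a # drop i T | i a. i \<le> length T}"
| "edits Del T = {take i T @ drop (Suc i) T | i. i < length T}"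

text \<open>Additive sensitivity. The difference is taken in the integers, as it may be negative. For
  \<open>z78\<close> the set is finite, because \<open>z78 T \<le> length T\<close>; it is nonempty except for \<open>n = 0\<close> with
  \<open>Sub\<close> or \<open>Del\<close>, where the value is unspecified.\<close>

definition AS :: "edit \<Rightarrow> ('a list \<Rightarrow> nat) \<Rightarrow> nat \<Rightarrow> int" where
  "AS e c n = Max {int (c T') - int (c T) | T T'. length T = n \<and> T' \<in> edits e T}"

text \<open>The reading of \<open>\<Omega>\<close> that asks for the bound at infinitely many arguments only, rather than
  at all sufficiently large ones.\<close>

definition Omega_io :: "(nat \<Rightarrow> real) \<Rightarrow> (nat \<Rightarrow> real) set" where
  "Omega_io g = {f. \<exists>C>0. infinite {n. f n \<ge> C * g n}}"

end

theory Submission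
  imports Defs
begin

text \<open>Over the letters \<open>0, \<dots>, 2k\<close>, each listed once so that all of them are phrases, the run
  \<open>1 2 \<dots> 2k\<close> is cut into the pairs \<open>(1 2) (3 4) \<dots>\<close>, but into \<open>(0 1) (2 3) \<dots>\<close> when an extra
  \<open>0\<close> precedes it. The subsequent blocks \<open>1 2 #\<^sub>1, 3 4 #\<^sub>2, \<dots>\<close> with fresh letters \<open>#\<^sub>i\<close> are then
  single phrases in the first case and split into two phrases each in the second. Hence a single
  edit that creates the extra \<open>0\<close> costs about \<open>k\<close> phrases in a string of length about \<open>7k\<close>.\<close>

text \<open>A certificate for the greedy parse. It demands that the last phrase be new too, so a
  string ending inside a known phrase has none.\<close>

fun lz_phrases :: "'a list set \<Rightarrow> 'a list list \<Rightarrow> bool" where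
  "lz_phrases D [] \<longleftrightarrow> True"
| "lz_phrases D (f # fs) \<longleftrightarrow>
    f \<noteq> [] \<and> f \<notin> D \<and> (\<forall>l. 1 \<le> l \<and> l < length f \<longrightarrow> take l f \<in> D) \<and> lz_phrases (insert f D) fs"

lemma lz_phrases_append:
  "lz_phrases D (fs @ gs) \<longleftrightarrow> lz_phrases D fs \<and> lz_phrases (D \<union> set fs) gs"
  by (induction fs arbitrary: D) auto

lemma phrase_len_append:
  assumes "f \<noteq> []" and "f \<notin> D" and "\<And>l. 1 \<le> l \<Longrightarrow> l < length f \<Longrightarrow> take l f \<in> D"
  shows "phrase_len D (f @ R) = length f"
proof -
  let ?P = "\<lambda>l. 1 \<le> l \<and> l \<le> length (f @ R) \<and> take l (f @ R) \<notin> D"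
  have P: "?P (length f)" using assms by (cases f) auto
  moreover have "length f \<le> l" if "?P l" for l
  proof (rule ccontr)
    assume "\<not> length f \<le> l"
    with that assms(3)[of l] show False by simp
  qed
  ultimately have "(LEAST l. ?P l) = length f" by (rule Least_equality)
  with P show ?thesis unfolding phrase_len_def by (metis (no_types, lifting))
qed

lemma lz78_from_concat: "lz_phrases D fs \<Longrightarrow> lz78_from D (concat fs) = fs"
proof (induction fs arbitrary: D)
  case Nil
  then show ?case by (simp add: lz78_from.simps)
next
  case (Cons f fs)
  then have "phrase_len D (f @ concat fs) = length f" by (intro phrase_len_append) auto
  with Cons show ?case by (simp add: lz78_from.simps[of D "f @ concat fs"] Let_def)
qed

lemma z78_concat: "lz_phrases {} fs \<Longrightarrow> z78 (concat fs) = length fs"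
  by (simp add: z78_def lz78_def lz78_from_concat)

lemma length_lz78_from_le: "length (lz78_from D T) \<le> length T"
proof (induction D T rule: lz78_from.induct)
  case (1 D T)
  show ?case
  proof (cases "T = []")
    case True
    then show ?thesis by (simp add: lz78_from.simps)
  next
    case False
    have "length (lz78_from (insert (take (phrase_len D T) T) D) (drop (phrase_len D T) T))
      \<le> length T - phrase_len D T"
      using 1[OF False refl refl] by simp
    with False phrase_len_bounds[OF False, of D] show ?thesis
      by (subst lz78_from.simps) (simp add: Let_def)
  qed
qed

lemma z78_le_length: "z78 T \<le> length T"
  by (simp add: z78_def lz78_def length_lz78_from_le)

lemma length_edits_le: "T' \<in> edits e T \<Longrightarrow> length T' \<le> Suc (length T)"
  by (cases e) auto

text \<open>\<open>Max\<close> bounds its elements only on a finite set. There may be infinitely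
  many strings of the given length, but the differences lie in a bounded interval because
  \<open>z78\<close> is at most the length.\<close>

lemma AS_z78_ge:
  fixes T T' :: "'a list"
  assumes "T' \<in> edits e T"
  shows "int (z78 T') - int (z78 T) \<le> AS e (z78 :: 'a list \<Rightarrow> nat) (length T)"
  unfolding AS_def
proof (rule Max_ge)
  let ?S = "{int (z78 U') - int (z78 U) | (U :: 'a list) U'. length U = length T \<and> U' \<in> edits e U}"
  have "?S \<subseteq> {- int (length T)..int (Suc (length T))}"
  proof
    fix d assume "d \<in> ?S"
    then obtain U U' :: "'a list" where d: "d = int (z78 U') - int (z78 U)"
      and U: "length U = length T" "U' \<in> edits e U" by auto
    have "z78 U \<le> length T" "z78 U' \<le> Suc (length T)"
      using z78_le_length[of U] z78_le_length[of U'] length_edits_le[OF U(2)] U(1) by auto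
    with d show "d \<in> {- int (length T)..int (Suc (length T))}" by auto
  qed
  then show "finite ?S" by (rule finite_subset) simp
qed (use assms in blast)

text \<open>If all proper prefixes are known before the batch starts, its phrases interact only
  through distinctness, hence injectivity.\<close>

lemma lz_phrases_map:
  assumes "\<And>i. i < m \<Longrightarrow> g i \<noteq> [] \<and> g i \<notin> D"
    and "\<And>i l. i < m \<Longrightarrow> 1 \<le> l \<Longrightarrow> l < length (g i) \<Longrightarrow> take l (g i) \<in> D"
    and "inj_on g {..<m}"
  shows "lz_phrases D (map g [0..<m])"
  using assms
proof (induction m)
  case (Suc m)
  have "lz_phrases D (map g [0..<m])"
    using Suc.prems by (intro Suc.IH) (auto simp: inj_on_def)
  moreover have "g m \<notin> g ` {0..<m}"
    using Suc.prems(3) by (force simp: inj_on_def)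
  ultimately show ?case
    using Suc.prems(1,2)[of m] by (auto simp: lz_phrases_append)
qed simp

text \<open>The letter \<open>2k + 1\<close> ends the run in either factorization: it is a phrase of its own, or
  closes the last of the shifted pairs.\<close>

definition wit :: "nat \<Rightarrow> nat list \<Rightarrow> nat list" where
  "wit k w = [0..<2*k+1] @ w @ [1..<2*k+2] @ concat (map (\<lambda>i. [2*i+1, 2*i+2, 2*k+3+i]) [0..<k])"

lemma length_wit: "length (wit k w) = 7*k + 2 + length w"
proof -
  have "length (concat (map (\<lambda>i. [2*i+1, 2*i+2, 2*k+3+i]) [0..<j])) = 3 * j" for j
    by (induction j) auto
  then show ?thesis by (simp add: wit_def del: upt_Suc)
qed

lemma concat_singletons: "concat (map (\<lambda>i. [i]) xs) = xs"
  by (induction xs) auto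

text \<open>The offset \<open>c\<close> is 1 for the aligned and 0 for the shifted cutting of the
  run.\<close>

lemma concat_pairs: "concat (map (\<lambda>i. [2*i+c, 2*i+Suc c]) [0..<j]) = [c..<2*j+c]"
  by (induction j) auto

text \<open>These are the strings before the edit. Each insert is empty or exactly one phrase
  (\<open>[0, 0]\<close> extends the known \<open>[0]\<close>, and \<open>2*k+2\<close> is a fresh
  letter), so a phrase starts at the letter 1 of the run.\<close>

lemma z78_wit_aligned:
  assumes "ws \<in> {[], [[0, 0]], [[2*k+2]]}"
  shows "z78 (wit k (concat ws)) = 4*k + 2 + length ws"
proof -
  let ?a = "map (\<lambda>i::nat. [i]) [0..<2*k+1]"
  let ?b = "map (\<lambda>i. [2*i+1, 2*i+2]) [0..<k]"
  let ?c = "map (\<lambda>i. [2*i+1, 2*i+2, 2*k+3+i]) [0..<k]"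
  \<comment> \<open>The counts are \<open>2*k+1\<close>, \<open>length ws\<close>, \<open>k\<close>,
    1 and \<open>k\<close>.\<close>
  let ?fs = "?a @ ws @ ?b @ [[2*k+1]] @ ?c"
  have "concat ?fs = wit k (concat ws)"
    using concat_pairs[of 1 k] by (simp add: wit_def concat_singletons)
  moreover have "lz_phrases {} ?fs"
    unfolding lz_phrases_append
  proof (intro conjI)
    show "lz_phrases {} ?a" by (rule lz_phrases_map) (auto simp: inj_on_def)
    show "lz_phrases ({} \<union> set ?a) ws"
      using assms by (auto simp: less_Suc_eq image_iff simp del: upt_Suc)
    show "lz_phrases ({} \<union> set ?a \<union> set ws) ?b"
      using assms by (intro lz_phrases_map) (auto simp: inj_on_def less_Suc_eq)
    show "lz_phrases ({} \<union> set ?a \<union> set ws \<union> set ?b) [[2*k+1]]"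
      using assms by auto
    show "lz_phrases ({} \<union> set ?a \<union> set ws \<union> set ?b \<union> set [[2*k+1]]) ?c"
      using assms by (intro lz_phrases_map) (auto simp: inj_on_def less_Suc_eq)
  qed
  ultimately show ?thesis using z78_concat[of ?fs] by simp
qed

text \<open>The lone 0 is already a phrase, so it absorbs the 1 and every run pair starts with an
  even letter. The counts are \<open>2*k+1\<close>, \<open>k+1\<close> and
  \<open>2*k\<close>.\<close>

lemma z78_wit_shifted: "z78 (wit k [0]) = 5*k + 2"
proof -
  let ?a = "map (\<lambda>i::nat. [i]) [0..<2*k+1]"
  let ?b = "map (\<lambda>i. [2*i, 2*i+1]) [0..<Suc k]"
  let ?c = "\<lambda>j. concat (map (\<lambda>i. [[2*i+1, 2*i+2], [2*k+3+i]]) [0..<j])"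
  let ?D = "{} \<union> set ?a \<union> set ?b"
  let ?fs = "?a @ ?b @ ?c k"
  have *: "concat (?c j) = concat (map (\<lambda>i. [2*i+1, 2*i+2, 2*k+3+i]) [0..<j])"
    "length (?c j) = 2 * j" for j
    by (induction j) auto
  have "[0] @ [1..<2*k+2] = [0..<2*k+2]"
    by (simp add: upt_conv_Cons del: upt_Suc)
  then have "concat ?fs = wit k [0]"
    using concat_pairs[of 0 "Suc k"]
    by (simp add: wit_def concat_singletons *[simplified] del: upt_Suc)
  moreover have "lz_phrases {} ?fs"
    unfolding lz_phrases_append
  proof (intro conjI)
    show "lz_phrases {} ?a" by (rule lz_phrases_map) (auto simp: inj_on_def)
    show "lz_phrases ({} \<union> set ?a) ?b"
      by (intro lz_phrases_map) (auto simp: inj_on_def less_Suc_eq)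
    \<comment> \<open>Parity makes the pair opening a block new, so the phrase stops before the
      fresh letter, which becomes a phrase of its own.\<close>
    have odd_even: "2*i+1 \<noteq> 2*j" for i j :: nat by presburger
    \<comment> \<open>The bound on \<open>j\<close> keeps the first letter of each block among the
      listed single letters.\<close>
    have "lz_phrases ?D (?c j)" if "j \<le> k" for j
      using that
    proof (induction j)
      case (Suc j)
      have "[2*j+1, 2*j+2] \<notin> ?D \<union> set (?c j)" "[2*k+3+j] \<notin> ?D \<union> set (?c j)"
        using odd_even by auto
      moreover have "take l [2*j+1, 2*j+2] \<in> ?D" if "1 \<le> l" "l < 2" for l
      proof -
        have "l = 1" using that by simp
        with Suc.prems show ?thesis by auto
      qed
      moreover have "?c (Suc j) = ?c j @ [[2*j+1, 2*j+2], [2*k+3+j]]" by simp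
      ultimately show ?case
        using Suc.IH Suc.prems
        by (simp only: lz_phrases_append lz_phrases.simps) (auto simp: less_Suc_eq)
    qed simp
    then show "lz_phrases ?D (?c k)" by simp
  qed
  ultimately show ?thesis using z78_concat[of ?fs] by (simp add: *[simplified])
qed

text \<open>All three edits act at position \<open>2*k+1\<close>, just after the listed letters:
  replace \<open>2*k+2\<close> by 0, insert 0, or delete one of two zeros.\<close>

lemma wit_edit:
  obtains ws where "ws \<in> {[], [[0, 0]], [[2*k+2]]}" "wit k [0] \<in> edits e (wit k (concat ws))"
proof (cases e)
  case Sub
  let ?T = "wit k [2*k+2]"
  have "wit k [0] = ?T[2*k+1 := 0]" "2*k+1 < length ?T" "0 \<noteq> ?T ! (2*k+1)"
    by (simp_all add: length_wit) (simp_all add: wit_def list_update_append nth_append del: upt_Suc)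
  then have "wit k [0] \<in> edits e ?T" unfolding Sub edits.simps by blast
  then show ?thesis by (intro that[of "[[2*k+2]]"]) auto
next
  case Ins
  let ?T = "wit k []"
  have "wit k [0] = take (2*k+1) ?T @ 0 # drop (2*k+1) ?T" "2*k+1 \<le> length ?T"
    by (simp_all add: length_wit) (simp_all add: wit_def del: upt_Suc)
  then have "wit k [0] \<in> edits e ?T" unfolding Ins edits.simps by blast
  then show ?thesis by (intro that[of "[]"]) auto
next
  case Del
  let ?T = "wit k [0, 0]"
  have "wit k [0] = take (2*k+1) ?T @ drop (Suc (2*k+1)) ?T" "2*k+1 < length ?T"
    by (simp_all add: length_wit) (simp_all add: wit_def del: upt_Suc)
  then have "wit k [0] \<in> edits e ?T" unfolding Del edits.simps by blast
  then show ?thesis by (intro that[of "[[0, 0]]"]) auto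
qed

text \<open>The gain is \<open>5*k+2 - (4*k+2 + length ws)\<close> with at most one phrase in
  \<open>ws\<close>. The length varies with the edit type, as the insert has at most two
  letters.\<close>

lemma AS_z78_linear:
  obtains n where "7*k \<le> n" "n \<le> 7*k + 4" "int k - 1 \<le> AS e (z78 :: nat list \<Rightarrow> nat) n"
proof -
  obtain ws where ws: "ws \<in> {[], [[0, 0]], [[2*k+2]]}"
    and ed: "wit k [0] \<in> edits e (wit k (concat ws))" by (rule wit_edit)
  show ?thesis
  proof (rule that)
    show "7*k \<le> length (wit k (concat ws))" "length (wit k (concat ws)) \<le> 7*k + 4"
      using ws by (auto simp: length_wit)
    show "int k - 1 \<le> AS e (z78 :: nat list \<Rightarrow> nat) (length (wit k (concat ws)))"
      using AS_z78_ge[OF ed] ws unfolding z78_wit_shifted z78_wit_aligned[OF ws] by auto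
  qed
qed

theorem theorem8:
  fixes e :: edit
  shows "(\<lambda>n. real_of_int (AS e (z78 :: nat list \<Rightarrow> nat) n)) \<in> Omega_io (\<lambda>n. real n)"
proof -
  \<comment> \<open>Taking \<open>k = m+2\<close> gives a gain of at least \<open>m+1\<close> at a
    length of at most \<open>7*m+18\<close>, which is at most \<open>18*(m+1)\<close>; hence the
    constant 1/18.\<close>
  have "\<exists>n\<ge>m. real_of_int (AS e (z78 :: nat list \<Rightarrow> nat) n) \<ge> 1/18 * real n" for m
  proof -
    obtain n where n: "7*(m+2) \<le> n" "n \<le> 7*(m+2) + 4"
      and AS: "int (m+2) - 1 \<le> AS e (z78 :: nat list \<Rightarrow> nat) n" by (rule AS_z78_linear)
    have "real n \<le> 18 * (real m + 1)" using of_nat_mono[OF n(2), where 'a = real] by simp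
    moreover have "real m + 1 \<le> real_of_int (AS e (z78 :: nat list \<Rightarrow> nat) n)"
      using AS by linarith
    ultimately have "real n \<le> 18 * real_of_int (AS e (z78 :: nat list \<Rightarrow> nat) n)" by argo
    with n(1) show ?thesis by (intro exI[of _ n]) simp
  qed
  then have "infinite {n. real_of_int (AS e (z78 :: nat list \<Rightarrow> nat) n) \<ge> 1/18 * real n}"
    unfolding finite_nat_set_iff_bounded by (meson mem_Collect_eq not_le)
  then show ?thesis
    unfolding Omega_io_def by (intro CollectI exI[of _ "1/18"]) simp
qed

end
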